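(* Let $X$ be a compact Hausdorff space and let $A=C(X)$ be the $C^*$-algebra of complex continuous functions on $X$. Then for every $f\in\mathcal{U}_0(A)$, $$\mathrm{cel}(f)=2\pi\,\|\Omega(f)\|_Q.$$
   Context: $\mathcal{U}(A)=C(X,\mathbb{T})$ is the unitary group of $A$ with the norm topology and $\mathcal{U}_0(A)$ is its connected component of the identity. The exponential length is $\mathrm{cel}(f)=\inf\{\sum_{k=1}^n\|a_k\| : n\in\mathbb{N},\ a_1,\dots,a_n\in C(X,\mathbb{R}),\ f=\exp(\mathrm{i}a_1)\cdots\exp(\mathrm{i}a_n)\}$, with $\|\cdot\|$ the supremum norm. Let $P:\mathbb{R}\to\mathbb{R}/\mathbb{Z}$ be the projection. $\Omega:\mathcal{U}_0(A)\to C(X,\mathbb{R})/C(X,\mathbb{Z})=C(X,\mathbb{R}/\mathbb{Z})_0$ (identity component) is the canonical isomorphism induced from the isomorphism between $\mathbb{T}$ and $\mathbb{R}/\mathbb{Z}$ (with $e^{2\pi \mathrm{i}t}\leftrightarrow P(t)$). For $f\in C(X,\mathbb{R}/\mathbb{Z})_0$, $\|f\|_Q:=\inf\{\|f'\| : f'\in C(X,\mathbb{R}),\ P\circ f'=f\}$. *)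

theory Defs
  imports "HOL-Analysis.Analysis"
begin

section \<open>The quotient group \<open>\<real>/\<int>\<close>\<close>

quotient_type real_mod_int = real / "\<lambda>s t. s - t \<in> \<int>"
proof (rule equivpI)
  show "symp (\<lambda>s t. s - t \<in> (\<int>::real set))"
    by (rule sympI) (metis Ints_minus minus_diff_eq)
  show "transp (\<lambda>s t. s - t \<in> (\<int>::real set))"
    by (rule transpI) (metis Ints_add diff_add_cancel add_diff_eq)
qed (auto simp: reflp_def)

lift_definition proj_RZ :: "real \<Rightarrow> real_mod_int" is "\<lambda>t. t" .

lemma proj_RZ_eq_iff: "proj_RZ s = proj_RZ t \<longleftrightarrow> s - t \<in> \<int>"
  by transfer simp

lemma surj_proj_RZ: "surj proj_RZ"
  unfolding surj_def
proof
  show "\<exists>t. r = proj_RZ t" for r by transfer (metis Ints_0 diff_self)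
qed

lemma proj_RZ_cases [cases type: real_mod_int]:
  obtains t where "r = proj_RZ t"
  using surj_proj_RZ by blast

instantiation real_mod_int :: ab_group_add
begin

lift_definition zero_real_mod_int :: real_mod_int is 0 .

lift_definition plus_real_mod_int :: "real_mod_int \<Rightarrow> real_mod_int \<Rightarrow> real_mod_int" is "(+)"
  by (metis Ints_add add_diff_add)

lift_definition uminus_real_mod_int :: "real_mod_int \<Rightarrow> real_mod_int" is uminus
  by (metis Ints_minus minus_diff_minus)

lift_definition minus_real_mod_int :: "real_mod_int \<Rightarrow> real_mod_int \<Rightarrow> real_mod_int" is "(-)"
proof -
  fix a b c d :: real
  assume "a - b \<in> \<int>" "c - d \<in> \<int>"
  then have "(a - b) - (c - d) \<in> \<int>" by (rule Ints_diff)
  then show "a - c - (b - d) \<in> \<int>" by (simp add: algebra_simps)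
qed

instance by (standard; transfer) (simp_all add: algebra_simps)

end

text \<open>\<open>\<real>/\<int>\<close> carries the quotient topology, which the quotient metric induces.\<close>

instantiation real_mod_int :: metric_space
begin

definition dist_real_mod_int :: "real_mod_int \<Rightarrow> real_mod_int \<Rightarrow> real" where
  "dist r s = Inf {\<bar>a - b\<bar> | a b. proj_RZ a = r \<and> proj_RZ b = s}"

definition uniformity_real_mod_int :: "(real_mod_int \<times> real_mod_int) filter" where
  "(uniformity :: (real_mod_int \<times> real_mod_int) filter) =
     (INF e\<in>{0<..}. principal {(r, s). dist r s < e})"

definition open_real_mod_int :: "real_mod_int set \<Rightarrow> bool" where
  "open U \<longleftrightarrow> open (proj_RZ -` U)"

lemma dist_proj_RZ: "dist (proj_RZ a) (proj_RZ b) = \<bar>(a - b) - of_int (round (a - b))\<bar>"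
  unfolding dist_real_mod_int_def
proof (rule cInf_eq_minimum)
  have "proj_RZ (a - of_int (round (a - b))) = proj_RZ a"
    by (simp add: proj_RZ_eq_iff)
  moreover have "\<bar>(a - b) - of_int (round (a - b))\<bar> = \<bar>(a - of_int (round (a - b))) - b\<bar>"
    by (simp add: algebra_simps)
  ultimately show "\<bar>(a - b) - of_int (round (a - b))\<bar>
      \<in> {\<bar>c - d\<bar> | c d. proj_RZ c = proj_RZ a \<and> proj_RZ d = proj_RZ b}"
    by blast
next
  fix x assume "x \<in> {\<bar>c - d\<bar> | c d. proj_RZ c = proj_RZ a \<and> proj_RZ d = proj_RZ b}"
  then obtain c d where x: "x = \<bar>c - d\<bar>" and "c - a \<in> \<int>" "d - b \<in> \<int>"
    by (auto simp: proj_RZ_eq_iff)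
  then obtain m n where "c = a + of_int m" "d = b + of_int n"
    by (metis Ints_cases add.commute diff_add_cancel)
  then have "x = \<bar>(a - b) - of_int (n - m)\<bar>"
    using x by (simp add: algebra_simps)
  then show "\<bar>(a - b) - of_int (round (a - b))\<bar> \<le> x"
    by (simp only: round_diff_minimal)
qed

lemma dist_proj_RZ_le: "dist (proj_RZ a) (proj_RZ b) \<le> \<bar>a - b\<bar>"
  unfolding dist_proj_RZ using round_diff_minimal[of "a - b" 0] by simp

lemma dist_proj_RZ_attained:
  obtains c where "proj_RZ c = proj_RZ a" "dist (proj_RZ a) (proj_RZ b) = \<bar>c - b\<bar>"
proof
  show "proj_RZ (a - of_int (round (a - b))) = proj_RZ a"
    by (simp add: proj_RZ_eq_iff)
  show "dist (proj_RZ a) (proj_RZ b) = \<bar>(a - of_int (round (a - b))) - b\<bar>"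
    by (simp add: dist_proj_RZ algebra_simps)
qed

instance
proof
  show unif: "uniformity = (INF e\<in>{0<..}. principal {(r, s :: real_mod_int). dist r s < e})"
    by (rule uniformity_real_mod_int_def)
  show eq0: "dist r s = 0 \<longleftrightarrow> r = s" for r s :: real_mod_int
  proof (cases r, cases s)
    fix a b assume rs: "r = proj_RZ a" "s = proj_RZ b"
    show ?thesis
    proof
      assume "dist r s = 0"
      then have "a - b = of_int (round (a - b))" by (simp add: rs dist_proj_RZ)
      then show "r = s" unfolding rs proj_RZ_eq_iff by (metis Ints_of_int)
    next
      assume "r = s"
      then obtain n where "a - b = of_int n" by (auto simp: rs proj_RZ_eq_iff elim: Ints_cases)
      then show "dist r s = 0" by (simp add: rs dist_proj_RZ)
    qed
  qed
  show tri: "dist r s \<le> dist r t + dist s t" for r s t :: real_mod_int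
  proof (cases r, cases s, cases t)
    fix a b c assume *: "r = proj_RZ a" "s = proj_RZ b" "t = proj_RZ c"
    obtain a' where a': "proj_RZ a' = r" "dist r t = \<bar>a' - c\<bar>"
      using dist_proj_RZ_attained * by metis
    obtain b' where b': "proj_RZ b' = s" "dist s t = \<bar>b' - c\<bar>"
      using dist_proj_RZ_attained * by metis
    have "dist r s \<le> \<bar>a' - b'\<bar>" using dist_proj_RZ_le[of a' b'] a' b' by simp
    also have "\<dots> \<le> \<bar>a' - c\<bar> + \<bar>b' - c\<bar>" by simp
    finally show ?thesis by (simp add: a' b')
  qed
  have sym: "dist r s = dist s r" for r s :: real_mod_int
    using tri[of r s r] tri[of s r s] eq0[of r r] eq0[of s s] by simp
  show "open U \<longleftrightarrow> (\<forall>x\<in>U. \<forall>\<^sub>F (x', y) in uniformity. x' = x \<longrightarrow> y \<in> U)"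
    for U :: "real_mod_int set"
  proof -
    have "(\<forall>\<^sub>F (x', y) in uniformity. x' = x \<longrightarrow> y \<in> U) \<longleftrightarrow>
        (\<exists>e>0. \<forall>y. dist x y < e \<longrightarrow> y \<in> U)" for x
      unfolding unif
      by (subst eventually_INF_base)
         (auto simp: eventually_principal Bex_def subset_eq intro: exI[of _ "min _ _"])
    moreover have "open (proj_RZ -` U) \<longleftrightarrow> (\<forall>x\<in>U. \<exists>e>0. \<forall>y. dist x y < e \<longrightarrow> y \<in> U)"
    proof
      assume L: "open (proj_RZ -` U)"
      show "\<forall>x\<in>U. \<exists>e>0. \<forall>y. dist x y < e \<longrightarrow> y \<in> U"
      proof
        fix x assume "x \<in> U"
        obtain a where a: "x = proj_RZ a" by (cases x)
        then obtain e where e: "e > 0" "\<And>b. \<bar>b - a\<bar> < e \<Longrightarrow> proj_RZ b \<in> U"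
          using L \<open>x \<in> U\<close> unfolding open_dist by (auto simp: dist_real_def)
        have "y \<in> U" if "dist x y < e" for y
        proof -
          obtain b where b: "y = proj_RZ b" by (cases y)
          obtain c where "proj_RZ c = y" "dist y x = \<bar>c - a\<bar>"
            using dist_proj_RZ_attained a b by metis
          then show ?thesis using e(2)[of c] that sym by auto
        qed
        then show "\<exists>e>0. \<forall>y. dist x y < e \<longrightarrow> y \<in> U" using e(1) by blast
      qed
    next
      assume R: "\<forall>x\<in>U. \<exists>e>0. \<forall>y. dist x y < e \<longrightarrow> y \<in> U"
      show "open (proj_RZ -` U)"
        unfolding open_dist
      proof
        fix a assume "a \<in> proj_RZ -` U"
        then obtain e where e: "e > 0" "\<And>y. dist (proj_RZ a) y < e \<Longrightarrow> y \<in> U"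
          using R by auto
        have "proj_RZ b \<in> U" if "dist b a < e" for b
          using e(2) dist_proj_RZ_le[of a b] that
          by (simp add: dist_real_def abs_minus_commute)
        then show "\<exists>e>0. \<forall>y. dist y a < e \<longrightarrow> y \<in> proj_RZ -` U" using e(1) by auto
      qed
    qed
    ultimately show ?thesis by (simp add: open_real_mod_int_def)
  qed
qed

end

text \<open>The isomorphism \<open>\<real>/\<int> \<rightarrow> \<T>\<close> and its inverse.\<close>

lift_definition circle_of_RZ :: "real_mod_int \<Rightarrow> complex" is "\<lambda>t. exp (2 * pi * \<i> * of_real t)"
proof -
  fix s t :: real assume "s - t \<in> \<int>"
  then obtain n where "s = t + of_int n" by (metis Ints_cases add.commute diff_add_cancel)
  then show "exp (2 * pi * \<i> * of_real s) = exp (2 * pi * \<i> * of_real t)"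
    unfolding exp_eq by (intro exI[of _ n]) (simp add: algebra_simps)
qed

definition RZ_of_circle :: "complex \<Rightarrow> real_mod_int" where
  "RZ_of_circle = inv_into UNIV circle_of_RZ"

lemma circle_of_RZ_proj: "circle_of_RZ (proj_RZ t) = exp (2 * pi * \<i> * of_real t)"
  by transfer simp

lemma circle_of_RZ_add: "circle_of_RZ (r + s) = circle_of_RZ r * circle_of_RZ s"
  by transfer (simp add: algebra_simps exp_add)

lemma bij_betw_circle_of_RZ: "bij_betw circle_of_RZ UNIV (sphere 0 1)"
proof (rule bij_betw_imageI)
  show "inj circle_of_RZ"
  proof (rule injI)
    fix r s assume "circle_of_RZ r = circle_of_RZ s"
    then show "r = s"
    proof transfer
      fix s t :: real
      assume "exp (2 * pi * \<i> * of_real s) = exp (2 * pi * \<i> * of_real t)"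
      then obtain n :: int where
        "2 * pi * \<i> * of_real s = 2 * pi * \<i> * of_real t + of_int (2 * n) * pi * \<i>"
        unfolding exp_eq by blast
      then have "(2 * pi * \<i>) * of_real s = (2 * pi * \<i>) * (of_real t + of_int n)"
        by (simp add: algebra_simps)
      then have "complex_of_real s = complex_of_real (t + of_int n)"
        by (subst (asm) mult_cancel_left) simp
      then have "s = t + of_int n" using of_real_eq_iff by blast
      then show "s - t \<in> \<int>" by simp
    qed
  qed
  have "circle_of_RZ r \<in> sphere 0 1" for r by (cases r) (simp add: circle_of_RZ_proj)
  moreover have "z \<in> range circle_of_RZ" if z: "z \<in> sphere 0 1" for z
  proof -
    have "z \<noteq> 0" "cmod z = 1" using z by auto
    then have "z = exp (\<i> * of_real (Arg z))" using Arg_eq[of z] by simp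
    also have "\<dots> = circle_of_RZ (proj_RZ (Arg z / (2 * pi)))"
      by (simp add: circle_of_RZ_proj)
    finally show ?thesis by blast
  qed
  ultimately show "range circle_of_RZ = sphere 0 1" by blast
qed

lemma RZ_of_circle_exp: "RZ_of_circle (exp (2 * pi * \<i> * of_real t)) = proj_RZ t"
  unfolding RZ_of_circle_def circle_of_RZ_proj[symmetric]
  using bij_betw_circle_of_RZ by (simp add: bij_betw_def)

lemma dist_circle_of_RZ: "dist (circle_of_RZ r) (circle_of_RZ s) = 2 * sin (pi * dist r s)"
proof (cases r, cases s)
  fix a b assume rs: "r = proj_RZ a" "s = proj_RZ b"
  obtain c where c: "proj_RZ c = r" "dist r s = \<bar>c - b\<bar>"
    using dist_proj_RZ_attained rs by metis
  have half: "dist r s \<le> 1 / 2"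
    unfolding rs dist_proj_RZ using of_int_round_abs_le[of "a - b"] by (simp add: abs_minus_commute)
  have "dist (circle_of_RZ r) (circle_of_RZ s) =
      norm (exp (\<i> * of_real (2 * pi * c)) - exp (\<i> * of_real (2 * pi * b)))"
    by (simp add: dist_norm rs(2) circle_of_RZ_proj algebra_simps flip: c(1))
  also have "\<dots> = norm (exp (\<i> * of_real (2 * pi * b)) * (exp (\<i> * of_real (2 * pi * (c - b))) - 1))"
    by (simp add: algebra_simps exp_diff)
  also have "\<dots> = 2 * \<bar>sin (pi * (c - b))\<bar>"
    using dist_exp_i_1[of "2 * pi * (c - b)"] by (simp add: norm_mult)
  also have "\<bar>sin (pi * (c - b))\<bar> = sin (pi * dist r s)"
  proof -
    have "sin (pi * dist r s) \<ge> 0" using half by (intro sin_ge_zero) auto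
    moreover have "sin (pi * (b - c)) = - sin (pi * (c - b))"
      using sin_minus[of "pi * (c - b)"] by (simp add: algebra_simps)
    ultimately show ?thesis by (auto simp: c(2) abs_if split: if_splits)
  qed
  finally show ?thesis .
qed

lemma dist_RZ_le_half: "dist r s \<le> 1 / 2" for r s :: real_mod_int
proof (cases r, cases s)
  fix a b assume "r = proj_RZ a" "s = proj_RZ b"
  then show ?thesis
    using of_int_round_abs_le[of "a - b"] by (simp add: dist_proj_RZ abs_minus_commute)
qed

lemma dist_circle_of_RZ_le: "dist (circle_of_RZ r) (circle_of_RZ s) \<le> 2 * pi * dist r s"
  using sin_x_le_x[of "pi * dist r s"] by (simp add: dist_circle_of_RZ)

lemma circle_of_RZ_of_circle: "cmod z = 1 \<Longrightarrow> circle_of_RZ (RZ_of_circle z) = z"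
  unfolding RZ_of_circle_def using bij_betw_circle_of_RZ
  by (intro f_inv_into_f) (auto simp: bij_betw_def)

lemma RZ_of_circle_of_RZ: "RZ_of_circle (circle_of_RZ r) = r"
  unfolding RZ_of_circle_def using bij_betw_circle_of_RZ by (simp add: bij_betw_def)

lemma cmod_circle_of_RZ: "cmod (circle_of_RZ r) = 1"
  by (cases r) (simp add: circle_of_RZ_proj)

lemma RZ_of_circle_mult:
  "cmod z = 1 \<Longrightarrow> cmod w = 1 \<Longrightarrow> RZ_of_circle (z * w) = RZ_of_circle z + RZ_of_circle w"
  by (metis RZ_of_circle_of_RZ circle_of_RZ_add circle_of_RZ_of_circle)

lemma dist_RZ_of_circle_le:
  assumes "cmod z = 1" "cmod w = 1"
  shows "dist (RZ_of_circle z) (RZ_of_circle w) \<le> dist z w"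
proof -
  define d where "d = dist (RZ_of_circle z) (RZ_of_circle w)"
  have d: "0 \<le> d" "d \<le> 1 / 2" using dist_RZ_le_half[of "RZ_of_circle z"] by (simp_all add: d_def)
  have *: "dist z w = 2 * sin (pi * d)"
    using dist_circle_of_RZ[of "RZ_of_circle z" "RZ_of_circle w"] assms
    by (simp add: circle_of_RZ_of_circle d_def)
  have "d \<le> 2 * sin (pi * d)"
  proof -
    have small: "5 / 6 * y \<le> sin y" if y: "0 \<le> y" "y \<le> 1" for y :: real
    proof -
      have "\<bar>sin y - y\<bar> \<le> y ^ 3 / 6"
        using Maclaurin_sin_bound[of y 3] y
        by (simp add: eval_nat_numeral sin_coeff_def fact_numeral divide_simps)
      moreover have "y ^ 3 \<le> y" using y power_decreasing[of 1 3 y] by simp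
      ultimately show ?thesis by linarith
    qed
    show ?thesis
    proof (cases "pi * d \<le> 1")
      case True
      have "1 * d \<le> pi * d" using d(1) pi_gt3 by (intro mult_right_mono) auto
      then show ?thesis using small[of "pi * d"] True d(1) by simp
    next
      case False
      have "sin 1 \<le> sin (pi * d)"
        using False d(2) pi_gt3 by (intro sin_monotone_2pi_le) auto
      then show ?thesis using small[of 1] d(2) by simp
    qed
  qed
  then show ?thesis by (simp add: * flip: d_def)
qed

section \<open>Function spaces\<close>

text \<open>
  Elements of \<open>C(X,M)\<close> are extensional on \<^term>\<open>topspace X\<close>, and \<^const>\<open>cfunspace\<close> supplies the
  uniform metric; the boundedness it requires is automatic for compact \<open>X\<close>.
\<close>

abbreviation CX :: "'a topology \<Rightarrow> ('a \<Rightarrow> 'b::metric_space) metric" where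
  "CX X \<equiv> cfunspace X euclidean_metric"

text \<open>The element 0 is inserted only to make the norm 0 when \<open>X\<close> is empty.\<close>

definition sup_norm :: "'a topology \<Rightarrow> ('a \<Rightarrow> 'b::real_normed_vector) \<Rightarrow> real" where
  "sup_norm X f = Sup (insert 0 ((\<lambda>x. norm (f x)) ` topspace X))"

definition unitary_top :: "'a topology \<Rightarrow> ('a \<Rightarrow> complex) topology" where
  "unitary_top X = subtopology (mtopology_of (CX X)) {f. \<forall>x\<in>topspace X. cmod (f x) = 1}"

definition U0 :: "'a topology \<Rightarrow> ('a \<Rightarrow> complex) set" where
  "U0 X = connected_component_of_set (unitary_top X) (\<lambda>x\<in>topspace X. 1)"

definition C_RZ_0 :: "'a topology \<Rightarrow> ('a \<Rightarrow> real_mod_int) set" where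
  "C_RZ_0 X = connected_component_of_set (mtopology_of (CX X)) (\<lambda>x\<in>topspace X. 0)"

section \<open>The isomorphism \<open>\<Omega>\<close>\<close>

definition Omega :: "'a topology \<Rightarrow> ('a \<Rightarrow> complex) \<Rightarrow> ('a \<Rightarrow> real_mod_int)" where
  "Omega X f = (\<lambda>x\<in>topspace X. RZ_of_circle (f x))"

lemma Lipschitz_map_compose:
  fixes h :: "'b::metric_space \<Rightarrow> 'c::metric_space"
  assumes h: "\<And>u v. u \<in> S \<Longrightarrow> v \<in> S \<Longrightarrow> dist (h u) (h v) \<le> K * dist u v"
  shows "continuous_map
    (subtopology (mtopology_of (CX X)) {f. \<forall>x\<in>topspace X. f x \<in> S}) (mtopology_of (CX X))
    (\<lambda>f. \<lambda>x\<in>topspace X. h (f x))"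
proof -
  let ?F = "{f. \<forall>x\<in>topspace X. f x \<in> S}"
  let ?H = "\<lambda>f. \<lambda>x\<in>topspace X. h (f x)"
  have contS: "continuous_on S h"
  proof (rule lipschitz_on_continuous_on)
    show "(max K 0)-lipschitz_on S h"
    proof (rule lipschitz_onI)
      fix u v assume "u \<in> S" "v \<in> S"
      then have "dist (h u) (h v) \<le> K * dist u v" by (rule h)
      also have "\<dots> \<le> max K 0 * dist u v" by (rule mult_right_mono) auto
      finally show "dist (h u) (h v) \<le> max K 0 * dist u v" .
    qed simp
  qed
  have maps: "?H f \<in> mspace (CX X)" if f: "f \<in> mspace (CX X)" "f \<in> ?F" for f
  proof -
    have cf: "continuous_map X euclidean f" and bf: "bounded (f ` topspace X)"
      using f(1) by auto
    have fS: "f ` topspace X \<subseteq> S" using f(2) by auto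
    have "continuous_map X (top_of_set S) f"
      using cf fS by (auto simp: continuous_map_in_subtopology)
    then have "continuous_map X euclidean (h \<circ> f)"
      using contS by (auto intro: continuous_map_compose)
    then have c: "continuous_map X euclidean (?H f)"
      by (rule continuous_map_eq) simp
    have "bounded (h ` f ` topspace X)"
    proof -
      obtain B where B: "\<And>u v. u \<in> f ` topspace X \<Longrightarrow> v \<in> f ` topspace X \<Longrightarrow> dist u v \<le> B"
        using bf by (metis bounded_two_points)
      have "dist (h u) (h v) \<le> \<bar>K\<bar> * B" if "u \<in> f ` topspace X" "v \<in> f ` topspace X" for u v
      proof -
        have "dist (h u) (h v) \<le> K * dist u v" using h that fS by blast
        also have "\<dots> \<le> \<bar>K\<bar> * dist u v" by (intro mult_right_mono) auto
        also have "\<dots> \<le> \<bar>K\<bar> * B" using B[OF that] by (intro mult_left_mono) auto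
        finally show ?thesis .
      qed
      then show ?thesis unfolding bounded_two_points by blast
    qed
    moreover have "?H f ` topspace X = h ` f ` topspace X" by force
    ultimately show ?thesis using c by auto
  qed
  have "Lipschitz_continuous_map (submetric (CX X) ?F) (CX X) ?H"
    unfolding Lipschitz_continuous_map_def
  proof (intro conjI exI ballI)
    show "?H \<in> mspace (submetric (CX X) ?F) \<rightarrow> mspace (CX X)"
      using maps by (simp del: mspace_cfunspace)
    fix f g assume f: "f \<in> mspace (submetric (CX X) ?F)" and g: "g \<in> mspace (submetric (CX X) ?F)"
    then have fC: "f \<in> mspace (CX X)" "f \<in> ?F" and gC: "g \<in> mspace (CX X)" "g \<in> ?F"
      by (simp_all del: mspace_cfunspace)
    show "mdist (CX X) (?H f) (?H g) \<le> \<bar>K\<bar> * mdist (submetric (CX X) ?F) f g"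
    proof (cases "topspace X = {}")
      case True
      then have "f = g" "?H f = ?H g" using fC gC by auto
      then show ?thesis 
        using mdist_zero[OF gC(1) gC(1)] mdist_zero[OF maps[OF gC] maps[OF gC]] by simp
    next
      case False
      have "dist (h (f x)) (h (g x)) \<le> \<bar>K\<bar> * mdist (CX X) f g" if "x \<in> topspace X" for x
      proof -
        have "dist (f x) (g x) \<le> mdist (CX X) f g"
          using cfunspace_mdist_le[OF fC(1) gC(1) False] that by fastforce
        moreover have "dist (h (f x)) (h (g x)) \<le> K * dist (f x) (g x)"
          using h that fC(2) gC(2) by blast
        moreover have "K * dist (f x) (g x) \<le> \<bar>K\<bar> * dist (f x) (g x)"
          by (intro mult_right_mono) auto
        ultimately show ?thesis
          by (meson abs_ge_zero mult_left_mono order_trans)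
      qed
      then show ?thesis
        using cfunspace_mdist_le[OF maps[OF fC] maps[OF gC] False] by simp
    qed
  qed
  then show ?thesis
    using Lipschitz_continuous_imp_continuous_map by (force simp: mtopology_of_submetric)
qed

theorem homeomorphic_map_Omega: "homeomorphic_map (unitary_top X) (mtopology_of (CX X)) (Omega X)"
proof -
  let ?E = "\<lambda>g. \<lambda>x\<in>topspace X. circle_of_RZ (g x)"
  have cO: "continuous_map (unitary_top X) (mtopology_of (CX X)) (Omega X)"
    using Lipschitz_map_compose[of "sphere 0 1" RZ_of_circle 1 X] dist_RZ_of_circle_le
    by (simp add: unitary_top_def Omega_def[abs_def])
  have "continuous_map (mtopology_of (CX X)) (mtopology_of (CX X)) ?E"
    using Lipschitz_map_compose[of UNIV circle_of_RZ "2 * pi" X] dist_circle_of_RZ_le by simp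
  then have cE: "continuous_map (mtopology_of (CX X)) (unitary_top X) ?E"
    by (auto simp: unitary_top_def continuous_map_in_subtopology cmod_circle_of_RZ)
  have "homeomorphic_maps (unitary_top X) (mtopology_of (CX X)) (Omega X) ?E"
    unfolding homeomorphic_maps_def
  proof (intro conjI ballI cO cE)
    show "?E (Omega X f) = f" if "f \<in> topspace (unitary_top X)" for f
      using that
      by (intro extensionalityI[of _ "topspace X"])
         (auto simp: unitary_top_def Omega_def circle_of_RZ_of_circle)
    show "Omega X (?E g) = g" if "g \<in> topspace (mtopology_of (CX X))" for g
      using that
      by (intro extensionalityI[of _ "topspace X"]) (auto simp: Omega_def RZ_of_circle_of_RZ)
  qed
  then show ?thesis by (rule homeomorphic_maps_map[THEN iffD1, THEN conjunct1])
qed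

theorem bij_betw_Omega: "bij_betw (Omega X) (U0 X) (C_RZ_0 X)"
proof -
  have one: "(\<lambda>x\<in>topspace X. 1) \<in> topspace (unitary_top X)"
    by (auto simp: unitary_top_def intro: continuous_map_eq[of X euclidean "\<lambda>_. 1"]
        finite_subset[of _ "{1}"] finite_imp_bounded)
  have "RZ_of_circle 1 = 0"
    by (metis RZ_of_circle_exp exp_zero mult_zero_right of_real_0 zero_real_mod_int.abs_eq
        proj_RZ.abs_eq)
  then have "Omega X (\<lambda>x\<in>topspace X. 1) = (\<lambda>x\<in>topspace X. 0)"
    by (auto simp: Omega_def)
  then have "Omega X ` U0 X = C_RZ_0 X"
    using homeomorphic_map_connected_component_of[OF homeomorphic_map_Omega one]
    by (simp add: U0_def C_RZ_0_def)
  moreover have "inj_on (Omega X) (U0 X)"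
    by (rule inj_on_subset[OF homeomorphic_imp_injective_map[OF homeomorphic_map_Omega]])
       (auto simp: U0_def dest: connected_component_in_topspace)
  ultimately show ?thesis by (simp add: bij_betw_def)
qed

theorem Omega_mult:
  assumes "f \<in> U0 X" "g \<in> U0 X"
  shows "Omega X (\<lambda>x\<in>topspace X. f x * g x) = (\<lambda>x\<in>topspace X. Omega X f x + Omega X g x)"
proof -
  have "\<forall>x\<in>topspace X. cmod (f x) = 1 \<and> cmod (g x) = 1"
    using assms by (auto simp: U0_def unitary_top_def dest!: connected_component_in_topspace)
  then show ?thesis by (auto simp: Omega_def RZ_of_circle_mult)
qed

section \<open>Exponential length and the quotient norm\<close>

text \<open>
  Equality in \<open>C(X)\<close> is equality on \<^term>\<open>topspace X\<close>. The empty product (\<open>n = 0\<close>) contributes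
  nothing beyond \<open>exp (\<i> 0)\<close>. For compact \<open>X\<close> the infima below are over nonempty sets whenever
  \<^term>\<open>f \<in> U0 X\<close> and \<^term>\<open>g \<in> C_RZ_0 X\<close>, respectively.
\<close>

definition cel :: "'a topology \<Rightarrow> ('a \<Rightarrow> complex) \<Rightarrow> real" where
  "cel X f = Inf {(\<Sum>k=1..n. sup_norm X (a k)) | (n::nat) a.
     (\<forall>k\<in>{1..n}. a k \<in> mspace (CX X :: ('a \<Rightarrow> real) metric)) \<and>
     (\<forall>x\<in>topspace X. f x = (\<Prod>k=1..n. exp (\<i> * of_real (a k x))))}"

definition norm_Q :: "'a topology \<Rightarrow> ('a \<Rightarrow> real_mod_int) \<Rightarrow> real" where
  "norm_Q X g = Inf {sup_norm X h | h.
     h \<in> mspace (CX X :: ('a \<Rightarrow> real) metric) \<and> (\<forall>x\<in>topspace X. proj_RZ (h x) = g x)}"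

end

theory Submission
  imports Defs
begin

text \<open>
  A factorisation \<open>f = exp (\<i> a\<^sub>1) \<cdots> exp (\<i> a\<^sub>n)\<close> collapses to the single exponential of
  \<open>a\<^sub>1 + \<cdots> + a\<^sub>n\<close>, since the algebra is commutative, and the triangle inequality shows that this
  does not increase the length. Thus \<open>cel f\<close> is the infimum of the norms of the logarithms
  \<open>2 \<pi> h\<close> of \<open>f\<close>, where \<open>h\<close> runs over the lifts of \<open>\<Omega>(f)\<close>. A lift exists because the unitaries
  with a continuous real logarithm form a clopen set: the quotient of two unitaries at distance
  less than 1 avoids the branch cut of the principal logarithm.
\<close>

section \<open>Membership in \<open>CX\<close> and sup-norm estimates\<close>

text \<open>Elements of \<open>CX X\<close> are extensional, hence the restriction; their
  boundedness is compactness of the image.\<close>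

lemma continuous_imp_mem_CX:
  fixes h :: "'a \<Rightarrow> 'b::metric_space"
  assumes "compact_space X" "continuous_map X euclidean h"
  shows "restrict h (topspace X) \<in> mspace (CX X)"
proof -
  have "compactin euclidean (h ` topspace X)"
    using assms unfolding compact_space_def by (rule image_compactin)
  then have "bounded (h ` topspace X)"
    unfolding compactin_euclidean_iff by (rule compact_imp_bounded)
  moreover have "continuous_map X euclidean (restrict h (topspace X))"
    using assms(2) by (rule continuous_map_eq) simp
  ultimately show ?thesis by simp
qed

lemma
  fixes h :: "'a \<Rightarrow> 'b::real_normed_vector"
  assumes "h \<in> mspace (CX X)"
  shows sup_norm_upper: "x \<in> topspace X \<Longrightarrow> norm (h x) \<le> sup_norm X h"
    and sup_norm_nonneg: "0 \<le> sup_norm X h"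
proof -
  have "bounded (h ` topspace X)" using assms by simp
  then have bdd: "bdd_above (insert 0 ((\<lambda>x. norm (h x)) ` topspace X))"
    by (simp add: bounded_imp_bdd_above bounded_norm_comp)
  show "x \<in> topspace X \<Longrightarrow> norm (h x) \<le> sup_norm X h"
    unfolding sup_norm_def using bdd by (intro cSup_upper) auto
  \<comment> \<open>The inserted 0 is itself an element of the set, so this covers empty
    \<open>X\<close> too.\<close>
  show "0 \<le> sup_norm X h"
    unfolding sup_norm_def using bdd by (intro cSup_upper) auto
qed

lemma sup_norm_least:
  assumes "0 \<le> B" "\<And>x. x \<in> topspace X \<Longrightarrow> norm (h x) \<le> B"
  shows "sup_norm X h \<le> B"
  unfolding sup_norm_def using assms by (intro cSup_least) auto

text \<open>Serves both directions of the comparison: \<open>c = 1 / (2 * pi)\<close> turns a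
  factorisation into one lift, and \<open>c = 2 * pi\<close> over a one-point index set turns a lift
  into a single exponent.\<close>

lemma sup_norm_scale_sum_le:
  fixes a :: "'i \<Rightarrow> 'a \<Rightarrow> 'b::real_normed_vector"
  assumes "\<And>k. k \<in> I \<Longrightarrow> a k \<in> mspace (CX X)"
  shows "sup_norm X (\<lambda>x\<in>topspace X. c *\<^sub>R (\<Sum>k\<in>I. a k x)) \<le> \<bar>c\<bar> * (\<Sum>k\<in>I. sup_norm X (a k))"
proof (rule sup_norm_least)
  show "0 \<le> \<bar>c\<bar> * (\<Sum>k\<in>I. sup_norm X (a k))"
    using assms by (intro mult_nonneg_nonneg sum_nonneg sup_norm_nonneg) auto
  fix x assume x: "x \<in> topspace X"
  have "norm (\<Sum>k\<in>I. a k x) \<le> (\<Sum>k\<in>I. sup_norm X (a k))"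
    using assms x by (intro sum_norm_le sup_norm_upper) auto
  then show "norm ((\<lambda>x\<in>topspace X. c *\<^sub>R (\<Sum>k\<in>I. a k x)) x) \<le> \<bar>c\<bar> * (\<Sum>k\<in>I. sup_norm X (a k))"
    using x by (simp add: mult_left_mono)
qed

section \<open>Real logarithms on the identity component\<close>

text \<open>The distance is symmetric, so \<open>step\<close> applies both ways and \<open>P\<close>
  is constant on every ball of radius \<open>e\<close>. The set where \<open>P\<close> holds is
  therefore clopen and cannot split a connected set.\<close>

lemma connectedin_mtopology_of_locally_constant:
  assumes C: "connectedin (mtopology_of m) C" and "x \<in> C" "P x" "y \<in> C"
    and "e > 0"
    and step: "\<And>u v. u \<in> mspace m \<Longrightarrow> v \<in> mspace m \<Longrightarrow> mdist m u v < e \<Longrightarrow> P u \<Longrightarrow> P v"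
  shows "P y"
proof -
  interpret Metric_space "mspace m" "mdist m" by (rule Metric_space_mspace_mdist)
  \<comment> \<open>Taking \<open>Q\<close> as the identity and as negation handles the set and its
    complement by one argument.\<close>
  have op: "openin (mtopology_of m) {u \<in> mspace m. Q (P u)}" for Q
    unfolding mtopology_of_def openin_mtopology
  proof (intro conjI allI impI)
    fix u assume u: "u \<in> {u \<in> mspace m. Q (P u)}"
    have "v \<in> {u \<in> mspace m. Q (P u)}" if "v \<in> mball u e" for v
    proof -
      have "P u = P v" using that step[of u v] step[of v u] by (auto simp: commute)
      then show ?thesis using that u by auto
    qed
    then show "\<exists>r>0. mball u r \<subseteq> {u \<in> mspace m. Q (P u)}" using \<open>e > 0\<close> by blast
  qed auto
  have "openin (mtopology_of m) {u \<in> mspace m. P u}"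
    using op[of "\<lambda>b. b"] by simp
  moreover have "closedin (mtopology_of m) {u \<in> mspace m. P u}"
  proof -
    have "mspace m - {u \<in> mspace m. P u} = {u \<in> mspace m. \<not> P u}" by auto
    then show ?thesis using op[of Not] by (simp add: closedin_def)
  qed
  ultimately have "C \<subseteq> {u \<in> mspace m. P u} \<or> disjnt C {u \<in> mspace m. P u}"
    using C connectedin_clopen_cases by blast
  moreover have "C \<subseteq> mspace m" using connectedin_subset_topspace[OF C] by simp
  ultimately show ?thesis using assms(2-4) by (auto simp: disjnt_iff)
qed

text \<open>The quotient \<open>q = g / f\<close> stays in the open right half-plane, where
  \<open>Ln\<close> is continuous, so \<open>h + Im (Ln q)\<close> is a logarithm of
  \<open>g\<close>.\<close>

lemma real_log_near:
  fixes f g :: "'a \<Rightarrow> complex"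
  assumes f: "continuous_map X euclidean f" "\<And>x. x \<in> topspace X \<Longrightarrow> cmod (f x) = 1"
    and g: "continuous_map X euclidean g" "\<And>x. x \<in> topspace X \<Longrightarrow> cmod (g x) = 1"
    and near: "\<And>x. x \<in> topspace X \<Longrightarrow> dist (f x) (g x) < 1"
    and h: "continuous_map X euclideanreal h"
      "\<And>x. x \<in> topspace X \<Longrightarrow> f x = exp (\<i> * of_real (h x))"
  obtains h' where "continuous_map X euclideanreal h'"
    "\<And>x. x \<in> topspace X \<Longrightarrow> g x = exp (\<i> * of_real (h' x))"
proof
  define q where "q = (\<lambda>x. g x / f x)"
  have q: "q x \<notin> \<real>\<^sub>\<le>\<^sub>0" "cmod (q x) = 1" if "x \<in> topspace X" for x
  proof -
    show 1: "cmod (q x) = 1" using f g that by (simp add: q_def norm_divide)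
    have "f x \<noteq> 0" using f(2)[OF that] by auto
    then have "g x - f x = f x * (q x - 1)" by (simp add: q_def field_simps)
    then have "cmod (g x - f x) = cmod (q x - 1)" using f(2)[OF that] by (simp add: norm_mult)
    then have "cmod (1 - q x) < 1"
      using near[OF that] by (simp add: dist_norm norm_minus_commute)
    then have "Re (q x) > 0" using complex_Re_le_cmod[of "1 - q x"] by simp
    then show "q x \<notin> \<real>\<^sub>\<le>\<^sub>0" by (auto simp: complex_nonpos_Reals_iff)
  qed
  have "continuous_map X euclidean q"
    \<comment> \<open>Continuity is checked point by point because \<open>f\<close> is known to be
      nonzero only on \<open>topspace X\<close>.\<close>
    unfolding continuous_map_atin limitin_canonical_iff q_def
  proof (intro ballI tendsto_divide)
    fix x assume x: "x \<in> topspace X"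
    show "(f \<longlongrightarrow> f x) (atin X x)" "(g \<longlongrightarrow> g x) (atin X x)"
      using f(1) g(1) x by (auto simp: continuous_map_atin limitin_canonical_iff)
    show "f x \<noteq> 0" using f(2)[OF x] by auto
  qed
  then have "continuous_map X (top_of_set (- \<real>\<^sub>\<le>\<^sub>0)) q"
    using q(1) by (auto simp: continuous_map_in_subtopology)
  moreover have "continuous_on (- \<real>\<^sub>\<le>\<^sub>0) (\<lambda>z. Im (Ln z))"
    by (intro continuous_intros) auto
  ultimately have "continuous_map X euclideanreal ((\<lambda>z. Im (Ln z)) \<circ> q)"
    by (auto intro: continuous_map_compose)
  then show "continuous_map X euclideanreal (\<lambda>x. h x + Im (Ln (q x)))"
    using h(1) by (intro continuous_map_add) (auto simp: o_def)
  fix x assume x: "x \<in> topspace X"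
  have "q x \<noteq> 0" using q(2)[OF x] by auto
  \<comment> \<open>The real part of \<open>Ln (q x)\<close> is the logarithm of the modulus 1, so
    the imaginary part carries all of \<open>Ln (q x)\<close>.\<close>
  then have "Re (Ln (q x)) = 0" using q(2)[OF x] by simp
  then have "\<i> * of_real (Im (Ln (q x))) = Ln (q x)" by (simp add: complex_eq_iff)
  then have "exp (\<i> * of_real (Im (Ln (q x)))) = q x" using \<open>q x \<noteq> 0\<close> by simp
  moreover have "g x = f x * q x" using f(2)[OF x] by (auto simp: q_def)
  ultimately show "g x = exp (\<i> * of_real (h x + Im (Ln (q x))))"
    using h(2)[OF x] by (simp add: distrib_left exp_add)
qed

lemma U0_imp_real_log:
  fixes f :: "'a \<Rightarrow> complex"
  assumes "f \<in> U0 X"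
  obtains h where "continuous_map X euclideanreal h"
    "\<And>x. x \<in> topspace X \<Longrightarrow> f x = exp (\<i> * of_real (h x))"
\<comment> \<open>The pointwise reading of \<open>mdist\<close> below needs a nonempty space; over
  an empty one any \<open>h\<close> works.\<close>
proof (cases "topspace X = {}")
  case True
  show ?thesis by (rule that[of "\<lambda>_. 0"]) (use True in auto)
next
  case False
  define S :: "('a \<Rightarrow> complex) set" where "S = {f. \<forall>x\<in>topspace X. cmod (f x) = 1}"
  define m where "m = submetric (CX X) S"
  have m: "unitary_top X = mtopology_of m"
    by (simp add: unitary_top_def m_def S_def mtopology_of_submetric)
  have f: "connected_component_of (mtopology_of m) (\<lambda>x\<in>topspace X. 1) f"
    using assms by (simp add: U0_def m)
  define P where "P = (\<lambda>f. \<exists>h. continuous_map X euclideanreal h \<and>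
    (\<forall>x\<in>topspace X. f x = exp (\<i> * of_real (h x))))"
  let ?C = "connected_component_of_set (mtopology_of m) (\<lambda>x\<in>topspace X. 1)"
  have "P f"
  \<comment> \<open>The base point, the constant 1, has logarithm 0; radius 1 is what
    \<open>real_log_near\<close> tolerates.\<close>
  proof (rule connectedin_mtopology_of_locally_constant[where C = ?C and e = 1
        and x = "\<lambda>x\<in>topspace X. 1"])
    show "connectedin (mtopology_of m) ?C"
      by (rule connectedin_connected_component_of)
    show "(\<lambda>x\<in>topspace X. 1) \<in> ?C" "f \<in> ?C"
      using f connected_component_in_topspace[OF f]
      by (simp_all add: connected_component_of_refl del: topspace_mtopology_of)
    show "P (\<lambda>x\<in>topspace X. 1)"
      unfolding P_def by (intro exI[of _ "\<lambda>_. 0"]) auto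
    fix u v assume u: "u \<in> mspace m" and v: "v \<in> mspace m"
      and d: "mdist m u v < 1" and "P u"
    then obtain h where h: "continuous_map X euclideanreal h"
      "\<And>x. x \<in> topspace X \<Longrightarrow> u x = exp (\<i> * of_real (h x))"
      unfolding P_def by blast
    have uv: "u \<in> mspace (CX X)" "u \<in> S" "v \<in> mspace (CX X)" "v \<in> S"
      using u v by (simp_all add: m_def del: mspace_cfunspace)
    then have near: "dist (u x) (v x) < 1" if "x \<in> topspace X" for x
      using cfunspace_mdist_le[of u X euclidean_metric v "mdist m u v"] that d False
      by (fastforce simp: m_def)
    obtain h' where "continuous_map X euclideanreal h'"
      "\<And>x. x \<in> topspace X \<Longrightarrow> v x = exp (\<i> * of_real (h' x))"
      by (rule real_log_near[OF _ _ _ _ near h]) (use uv in \<open>auto simp: S_def\<close>)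
    then show "P v" unfolding P_def by blast
  qed simp
  then show ?thesis using that unfolding P_def by blast
qed

section \<open>Comparison of the two infima\<close>

text \<open>\<open>RZ_of_circle\<close> and \<open>circle_of_RZ\<close> are mutually inverse once
  \<open>f x\<close> lies on the unit circle; this trades lifts for logarithms.\<close>

lemma proj_RZ_eq_Omega_iff:
  assumes "x \<in> topspace X" "cmod (f x) = 1"
  shows "proj_RZ t = Omega X f x \<longleftrightarrow> f x = exp (\<i> * of_real (2 * pi * t))"
  using assms circle_of_RZ_of_circle[of "f x"] circle_of_RZ_proj[of t] RZ_of_circle_exp[of t]
  by (auto simp: Omega_def mult_ac)

text \<open>A monotone map that is continuous from the right at the infimum commutes with
  it.\<close>

lemma cInf_cmult:
  fixes S :: "real set"
  assumes "c > 0" "S \<noteq> {}" "bdd_below S"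
  shows "Inf ((*) c ` S) = c * Inf S"
proof -
  have "continuous (at_right (Inf S)) ((*) c)" by (intro continuous_intros)
  then show ?thesis
    using continuous_at_Inf_mono[of "(*) c" S] assms by (simp add: mono_def)
qed

theorem proposition4p3:
  fixes X :: "'a topology" and f :: "'a \<Rightarrow> complex"
  assumes "compact_space X" and "Hausdorff_space X"
    and "f \<in> U0 X"
  shows "cel X f = 2 * pi * norm_Q X (Omega X f)"
proof -
  have f1: "cmod (f x) = 1" if "x \<in> topspace X" for x
    using assms(3) that
    by (auto simp: U0_def unitary_top_def dest!: connected_component_in_topspace)
  \<comment> \<open>These are the lifts of \<open>Omega X f\<close>, written through
    \<open>exp\<close> to be comparable with \<open>factors\<close>.\<close>
  define lifts where "lifts = {h. h \<in> mspace (CX X :: ('a \<Rightarrow> real) metric) \<and>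
    (\<forall>x\<in>topspace X. f x = exp (\<i> * of_real (2 * pi * h x)))}"
  define factors where "factors = {(n::nat, a).
    (\<forall>k\<in>{1..n}. a k \<in> mspace (CX X :: ('a \<Rightarrow> real) metric)) \<and>
    (\<forall>x\<in>topspace X. f x = (\<Prod>k=1..n. exp (\<i> * of_real (a k x))))}"
  define L where "L = (\<lambda>(n, a). \<Sum>k=(1::nat)..n. sup_norm X (a k :: 'a \<Rightarrow> real))"
  have cel: "cel X f = Inf (L ` factors)"
    unfolding cel_def L_def factors_def by (rule arg_cong[of _ _ Inf]) (auto simp: image_iff)
  have norm_Q: "norm_Q X (Omega X f) = Inf (sup_norm X ` lifts)"
    unfolding norm_Q_def lifts_def
    by (rule arg_cong[of _ _ Inf]) (auto simp: image_iff proj_RZ_eq_Omega_iff f1)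
  have sum_lift: "\<exists>h\<in>lifts. 2 * pi * sup_norm X h \<le> L p" if p: "p \<in> factors" for p
  proof -
    obtain n a where pna: "p = (n, a)" by (cases p)
    have a: "\<And>k. k \<in> {1..n} \<Longrightarrow> a k \<in> mspace (CX X)"
      and fa: "\<And>x. x \<in> topspace X \<Longrightarrow> f x = (\<Prod>k=1..n. exp (\<i> * of_real (a k x)))"
      using p by (auto simp: factors_def pna simp del: mspace_cfunspace)
    \<comment> \<open>For \<open>n = 0\<close> this is the zero function, in agreement with the
      empty product 1.\<close>
    define h where "h = (\<lambda>x\<in>topspace X. (1 / (2 * pi)) *\<^sub>R (\<Sum>k=1..n. a k x))"
    have "h \<in> mspace (CX X)"
      unfolding h_def real_scaleR_def using assms(1) a
      by (intro continuous_imp_mem_CX continuous_map_real_mult_left continuous_map_sum) auto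
    moreover have "f x = exp (\<i> * of_real (2 * pi * h x))" if "x \<in> topspace X" for x
      using fa[OF that] that by (simp add: h_def exp_sum sum_distrib_left)
    ultimately have "h \<in> lifts" by (simp add: lifts_def del: mspace_cfunspace)
    moreover have "2 * pi * sup_norm X h \<le> L p"
      using sup_norm_scale_sum_le[of "{1..n}" a X "1 / (2 * pi)"] a
      by (simp add: h_def L_def pna field_simps del: mspace_cfunspace)
    ultimately show ?thesis by blast
  qed
  have single: "\<exists>p\<in>factors. L p \<le> 2 * pi * sup_norm X h" if h: "h \<in> lifts" for h
  proof -
    \<comment> \<open>One factor is enough; the constant sequence with value \<open>a\<close> is
      read only at index 1.\<close>
    define a where "a = (\<lambda>x\<in>topspace X. (2 * pi) *\<^sub>R h x)"
    have hC: "h \<in> mspace (CX X)" using h by (simp add: lifts_def)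
    then have "a \<in> mspace (CX X)"
      unfolding a_def real_scaleR_def using assms(1)
      by (intro continuous_imp_mem_CX) (auto intro!: continuous_map_real_mult_left)
    then have "(1, \<lambda>_. a) \<in> factors"
      using h by (simp add: factors_def lifts_def a_def del: mspace_cfunspace)
    moreover have "L (1, \<lambda>_. a) \<le> 2 * pi * sup_norm X h"
      using sup_norm_scale_sum_le[of "{()}" "\<lambda>_. h" X "2 * pi"] hC
      by (simp add: a_def L_def del: mspace_cfunspace)
    ultimately show ?thesis by blast
  qed
  \<comment> \<open>Here \<open>f \<in> U0 X\<close> yields a lift. By \<open>single\<close> there
    is then also a factorisation, so neither infimum is over the empty set.\<close>
  obtain h where h: "continuous_map X euclideanreal h"
    "\<And>x. x \<in> topspace X \<Longrightarrow> f x = exp (\<i> * of_real (h x))"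
    using U0_imp_real_log[OF assms(3)] by blast
  have "(\<lambda>x\<in>topspace X. h x / (2 * pi)) \<in> lifts"
    using h continuous_imp_mem_CX[OF assms(1), of "\<lambda>x. h x / (2 * pi)"]
    by (simp add: lifts_def continuous_map_real_divide del: mspace_cfunspace)
  then have ne: "lifts \<noteq> {}" by blast
  have bdd: "bdd_below (sup_norm X ` lifts)"
    by (rule bdd_belowI[of _ 0]) (auto simp: lifts_def simp del: mspace_cfunspace intro: sup_norm_nonneg)
  \<comment> \<open>Every element of either set lies above some element of the other. As both are
    nonempty and bounded below by 0, their infima agree.\<close>
  have "cel X f = Inf ((*) (2 * pi) ` sup_norm X ` lifts)"
    unfolding cel
  proof (rule antisym)
    have "L p \<ge> 0" if "p \<in> factors" for p
      using that by (auto simp: L_def factors_def simp del: mspace_cfunspace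
          intro!: sum_nonneg sup_norm_nonneg)
    then have bddL: "bdd_below (L ` factors)" by (auto intro: bdd_belowI[of _ 0])
    show "Inf (L ` factors) \<le> Inf ((*) (2 * pi) ` sup_norm X ` lifts)"
      using ne single bddL by (intro cInf_mono) auto
    have "bdd_below ((*) (2 * pi) ` sup_norm X ` lifts)"
      by (rule bdd_belowI[of _ 0])
         (auto simp: lifts_def simp del: mspace_cfunspace
           intro!: mult_nonneg_nonneg sup_norm_nonneg)
    then show "Inf ((*) (2 * pi) ` sup_norm X ` lifts) \<le> Inf (L ` factors)"
      using ne single sum_lift by (intro cInf_mono) fastforce+
  qed
  also have "\<dots> = 2 * pi * Inf (sup_norm X ` lifts)"
    using ne bdd by (intro cInf_cmult) auto
  finally show ?thesis by (simp add: norm_Q)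
qed

end
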